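(* Let $J\subset[0,\infty)$ be an interval, $\lambda>0$, $\alpha\in\mathbb R$, $s\in\mathbb R$ and $p\in\mathbb N$ with $p\ge 2$. Let $g:(0,\infty)\to\mathbb R$ be of class $\mathcal C^2$. Assume that $g$ is $\mathcal C^p$ and $|g^{(p)}(y)|\ge\lambda y^{\alpha}$ on $J$ (i.e. for all $y\in J$, $y>0$). Then there exists $C>0$ such that for any $t\in\mathbb R\setminus\{0\}$, any $\delta>0$ and any $k\in\mathbb Z_J$, $$\sup_{x\in\mathbb R}|I^{s}_{t,x,k}|\le C\,\frac{2^{(s-\frac{\alpha}{p})k}\,\delta^{\frac{1-sp-p}{p}}}{|t|^{\frac1p}}.$$ Moreover, if $l\ge 2$ is a real number and $|g''(y)|\ge\lambda y^{\alpha}$ on $J$, there exists $C>0$ such that for any such $t,\delta,k$, $$\sup_{x\in\mathbb R}|I^{s}_{t,x,k}|\le C\,\frac{2^{(s+\frac{l-2-\alpha}{l})k}\,\delta^{\frac{1-sl-l}{l}}}{|t|^{\frac1l}}.$$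
   Context: Dimension $n=1$. $P$ is a fixed smooth even function on $\mathbb R$ supported in $\{\tfrac12\le|y|\le 2\}$. For $t\in\mathbb R$, $x\in\mathbb R$, $s\in\mathbb R$, $k\in\mathbb Z$, $\delta>0$, $$I^{s}_{t,x,k}:=\int_0^{\infty}e^{ix\xi}e^{i\frac t\delta g(\delta\xi)}P\big(\tfrac{\delta\xi}{2^k}\big)\xi^{s}\,d\xi.$$ For an interval $J\subset[0,\infty)$, $\mathbb Z_J:=\{k\in\mathbb Z:\ [2^{k-1},2^{k+1}]\subset J\}$. Constants $C$ may depend on $g,P,J,\lambda,\alpha,s,p,l$ but not on $t,\delta,k,x$. *)

theory Defs
  imports "HOL-Analysis.Analysis"
begin

text \<open>Derivatives are taken within \<open>S\<close>, hence one-sided at an endpoint of an interval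
  that belongs to \<open>S\<close>. The value \<open>nth_deriv S n f y\<close> is meaningful for \<open>y \<in> S\<close> not isolated
  in \<open>S\<close>, when the derivatives involved exist.\<close>

primrec nth_deriv :: "real set \<Rightarrow> nat \<Rightarrow> (real \<Rightarrow> 'a) \<Rightarrow> real \<Rightarrow> 'a::real_normed_vector" where
  "nth_deriv S 0 f = f"
| "nth_deriv S (Suc n) f = (\<lambda>y. vector_derivative (nth_deriv S n f) (at y within S))"

definition Cn_on :: "nat \<Rightarrow> (real \<Rightarrow> 'a::real_normed_vector) \<Rightarrow> real set \<Rightarrow> bool" where
  "Cn_on n f S \<longleftrightarrow>
     (\<forall>m<n. \<forall>y\<in>S. nth_deriv S m f differentiable (at y within S)) \<and>
     continuous_on S (nth_deriv S n f)"

definition osc_int ::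
  "(real \<Rightarrow> real) \<Rightarrow> (real \<Rightarrow> complex) \<Rightarrow> real \<Rightarrow> real \<Rightarrow> real \<Rightarrow> real \<Rightarrow> int \<Rightarrow> complex" where
  "osc_int g P \<delta> s t x k =
     (LINT \<xi>:{0<..}|lborel.
        exp (\<i> * of_real (x * \<xi>)) * exp (\<i> * of_real (t / \<delta> * g (\<delta> * \<xi>)))
        * P (\<delta> * \<xi> / 2 powi k) * of_real (\<xi> powr s))"

definition dyadic_indices :: "real set \<Rightarrow> int set" where
  "dyadic_indices J = {k. {2 powi (k - 1) .. 2 powi (k + 1)} \<subseteq> J}"

end

theory Submission
  imports Defs
begin

text \<open>Put \<open>M = 2\<^sup>k / \<delta>\<close>. The amplitude \<open>P (\<xi> / M) \<xi>\<^sup>s\<close> lives on \<open>[M/2, 2M]\<close> and has size and total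
  variation of order \<open>M\<^sup>s\<close>, while the \<open>p\<close>-th derivative of the phase \<open>x \<xi> + (t/\<delta>) g(\<delta> \<xi>)\<close> does
  not see \<open>x\<close> and has modulus at least a constant times \<open>\<Lambda> = |t| \<delta>\<^bsup>p-1\<^esup> 2\<^bsup>\<alpha>k\<^esup>\<close>. Van der Corput's
  lemma and an integration by parts against the amplitude give the bound \<open>M\<^sup>s \<Lambda>\<^bsup>-1/p\<^esup>\<close>, which is the
  first claim. For the second claim, the case \<open>p = 2\<close> reads \<open>M\<^bsup>s+1\<^esup> A\<^bsup>-1/2\<^esup>\<close> with \<open>A = \<Lambda> M\<^sup>2\<close>; together
  with the trivial bound \<open>M\<^bsup>s+1\<^esup>\<close> it yields \<open>M\<^bsup>s+1\<^esup> A\<^bsup>-1/l\<^esup>\<close> for every \<open>l \<ge> 2\<close>.\<close>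

section \<open>Van der Corput's lemma for unimodular integrands\<close>

lemma has_vector_derivative_cis [derivative_intros]:
  assumes "(\<phi> has_real_derivative \<phi>') (at y within S)"
  shows "((\<lambda>y. cis (\<phi> y)) has_vector_derivative \<phi>' *\<^sub>R (\<i> * cis (\<phi> y))) (at y within S)"
proof -
  have "((\<lambda>y. cis (\<phi> y)) has_derivative (\<lambda>t. (t * \<phi>') *\<^sub>R (\<i> * cis (\<phi> y)))) (at y within S)"
    using assms unfolding has_field_derivative_def
    by (intro has_derivative_cis) (simp add: mult.commute[of _ \<phi>'])
  then show ?thesis
    by (simp add: has_vector_derivative_def)
qed

lemma continuous_on_cis_comp [continuous_intros]:
  "continuous_on S \<phi> \<Longrightarrow> continuous_on S (\<lambda>y. cis (\<phi> y))"
  unfolding cis_conv_exp by (intro continuous_intros)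

text \<open>Lower bounds on derivatives are assumed on open intervals throughout, because cutting
  out a sublevel set gives control only strictly outside the middle piece. Continuity carries them
  to the end points.\<close>

lemma abs_ge_on_Icc:
  fixes h :: "real \<Rightarrow> real"
  assumes "continuous_on {a..b} h" "\<And>y. y \<in> {a<..<b} \<Longrightarrow> \<bar>h y\<bar> \<ge> \<mu>" "a < b" "y \<in> {a..b}"
  shows "\<bar>h y\<bar> \<ge> \<mu>"
  by (rule continuous_ge_on_Ioo[OF continuous_on_rabs[OF assms(1)] assms(2-4)])

text \<open>The antiderivative of \<open>cis \<phi>\<close> is, up to an error, \<open>cis \<phi> / (\<i> \<phi>')\<close>. The sign condition on
  \<open>\<phi>''\<close> makes the total variation of \<open>1/\<phi>'\<close> computable as a difference of end-point values.\<close>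

lemma van_der_corput_first:
  fixes \<phi> \<phi>' \<phi>'' :: "real \<Rightarrow> real"
  assumes "a \<le> b" "\<mu> > 0"
    and d1: "\<And>y. y \<in> {a..b} \<Longrightarrow> (\<phi> has_real_derivative \<phi>' y) (at y within {a..b})"
    and d2: "\<And>y. y \<in> {a..b} \<Longrightarrow> (\<phi>' has_real_derivative \<phi>'' y) (at y within {a..b})"
    and lower: "\<And>y. y \<in> {a<..<b} \<Longrightarrow> \<bar>\<phi>' y\<bar> \<ge> \<mu>"
    and sign: "\<And>y. y \<in> {a..b} \<Longrightarrow> \<bar>\<phi>'' y\<bar> = \<sigma> * \<phi>'' y" "\<bar>\<sigma>\<bar> = 1"
  shows "norm (integral {a..b} (\<lambda>y. cis (\<phi> y))) \<le> 4 / \<mu>"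
proof (cases "a = b")
  case True
  then show ?thesis using \<open>\<mu> > 0\<close> by simp
next
  case False
  with \<open>a \<le> b\<close> have "a < b" by simp
  have cont: "continuous_on {a..b} \<phi>" "continuous_on {a..b} \<phi>'"
    using DERIV_continuous_on[OF d1] DERIV_continuous_on[OF d2] by auto
  have lower': "\<bar>\<phi>' y\<bar> \<ge> \<mu>" if "y \<in> {a..b}" for y
    using abs_ge_on_Icc[OF cont(2) lower \<open>a < b\<close> that] by simp
  then have nz: "\<phi>' y \<noteq> 0" if "y \<in> {a..b}" for y
    using that \<open>\<mu> > 0\<close> by fastforce
  define u where "u y = 1 / \<phi>' y" for y
  define u' where "u' y = - \<phi>'' y / (\<phi>' y)\<^sup>2" for y
  define w where "w y = - \<i> * cis (\<phi> y)" for y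
  have u_le: "\<bar>u y\<bar> \<le> 1 / \<mu>" if "y \<in> {a..b}" for y
    unfolding u_def using lower'[OF that] \<open>\<mu> > 0\<close> by (simp add: frac_le)
  have du: "(u has_real_derivative u' y) (at y within {a..b})" if "y \<in> {a..b}" for y
    unfolding u_def u'_def
    using DERIV_inverse'[OF d2[OF that] nz[OF that]]
    by (simp add: power2_eq_square divide_inverse mult_ac)
  have dw: "(w has_vector_derivative \<phi>' y *\<^sub>R cis (\<phi> y)) (at y within {a..b})"
    if "y \<in> {a..b}" for y
    unfolding w_def
    using has_vector_derivative_mult_right[OF has_vector_derivative_cis[OF d1[OF that]], of "- \<i>"]
    by (simp add: algebra_simps)
  \<comment> \<open>Since \<open>w' = \<phi>' cis \<phi>\<close> and \<open>u \<phi>' = 1\<close>,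
    the product rule returns \<open>cis \<phi>\<close> plus the error \<open>u' w\<close>.\<close>
  have "((\<lambda>y. u y *\<^sub>R w y) has_vector_derivative (cis (\<phi> y) + u' y *\<^sub>R w y)) (at y within {a..b})"
    if "y \<in> {a..b}" for y
    using has_vector_derivative_scaleR[OF du[OF that] dw[OF that]] nz[OF that] by (simp add: u_def)
  then have ftc: "((\<lambda>y. cis (\<phi> y) + u' y *\<^sub>R w y) has_integral (u b *\<^sub>R w b - u a *\<^sub>R w a)) {a..b}"
    by (rule fundamental_theorem_of_calculus[OF \<open>a \<le> b\<close>])
  have int_cis: "(\<lambda>y. cis (\<phi> y)) integrable_on {a..b}"
    by (intro integrable_continuous_real continuous_intros cont)
  let ?I = "integral {a..b} (\<lambda>y. cis (\<phi> y))"
  have err: "((\<lambda>y. u' y *\<^sub>R w y) has_integral (u b *\<^sub>R w b - u a *\<^sub>R w a - ?I)) {a..b}"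
    using has_integral_diff[OF ftc integrable_integral[OF int_cis]] by simp
  \<comment> \<open>By the choice of \<open>\<sigma>\<close>, \<open>- \<sigma> * u'\<close> equals
    \<open>|u'|\<close>, so it dominates the error and integrates exactly.\<close>
  have var: "((\<lambda>y. - \<sigma> * u' y) has_integral (- \<sigma> * (u b - u a))) {a..b}"
    using fundamental_theorem_of_calculus[OF \<open>a \<le> b\<close>, of u u'] du
    by (intro has_integral_mult_right) (simp add: has_real_derivative_iff_has_vector_derivative)
  have "norm (u b *\<^sub>R w b - u a *\<^sub>R w a - ?I) \<le> - \<sigma> * (u b - u a)"
    unfolding integral_unique[OF err, symmetric] integral_unique[OF var, symmetric]
  proof (rule integral_norm_bound_integral)
    show "(\<lambda>y. u' y *\<^sub>R w y) integrable_on {a..b}" "(\<lambda>y. - \<sigma> * u' y) integrable_on {a..b}"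
      using err var by blast+
    show "norm (u' y *\<^sub>R w y) \<le> - \<sigma> * u' y" if "y \<in> {a..b}" for y
      using sign(1)[OF that] by (simp add: u'_def w_def norm_mult)
  qed
  moreover have "- \<sigma> * (u b - u a) \<le> \<bar>u b\<bar> + \<bar>u a\<bar>"
    using sign(2) by (auto simp: abs_if split: if_splits)
  moreover have "norm (u b *\<^sub>R w b) \<le> \<bar>u b\<bar>" "norm (u a *\<^sub>R w a) \<le> \<bar>u a\<bar>"
    by (simp_all add: w_def norm_mult)
  \<comment> \<open>The constant 4 arises here: two boundary terms, and an error that is again at
    most the two end-point values of \<open>|u|\<close>, each at most
    \<open>1 / \<mu>\<close>.\<close>
  moreover have "norm ?I \<le> norm (u b *\<^sub>R w b) + norm (u a *\<^sub>R w a) + norm (u b *\<^sub>R w b - u a *\<^sub>R w a - ?I)"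
  proof -
    have "norm z \<le> norm x + norm y + norm (x - y - z)" for x y z :: complex
      by norm
    then show ?thesis .
  qed
  moreover have "\<bar>u a\<bar> \<le> 1 / \<mu>" "\<bar>u b\<bar> \<le> 1 / \<mu>"
    using u_le \<open>a \<le> b\<close> by auto
  ultimately show ?thesis
    by simp
qed

text \<open>By the mean value theorem, two points with \<open>|h| < \<Lambda> \<epsilon>\<close> are
  at distance at most \<open>2 \<epsilon>\<close>, as \<open>h\<close> changes by less than
  \<open>2 \<Lambda> \<epsilon>\<close> between them but at rate at least \<open>\<Lambda>\<close>.
  The infimum and supremum of all such points serve as \<open>c\<close> and
  \<open>d\<close>.\<close>

lemma small_values_in_short_interval:
  fixes h h' :: "real \<Rightarrow> real"
  assumes "a \<le> b" "\<epsilon> > 0" "\<Lambda> > 0"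
    and d: "\<And>y. y \<in> {a..b} \<Longrightarrow> (h has_real_derivative h' y) (at y within {a..b})"
    and lower: "\<And>y. y \<in> {a<..<b} \<Longrightarrow> \<bar>h' y\<bar> \<ge> \<Lambda>"
  obtains c d where "a \<le> c" "c \<le> d" "d \<le> b" "d - c \<le> 2 * \<epsilon>"
    "\<And>y. y \<in> {a<..<c} \<Longrightarrow> \<bar>h y\<bar> \<ge> \<Lambda> * \<epsilon>" "\<And>y. y \<in> {d<..<b} \<Longrightarrow> \<bar>h y\<bar> \<ge> \<Lambda> * \<epsilon>"
proof -
  define Z where "Z = {y \<in> {a..b}. \<bar>h y\<bar> < \<Lambda> * \<epsilon>}"
  have close: "y - x \<le> 2 * \<epsilon>" if "x \<in> Z" "y \<in> Z" for x y
  proof (cases "x < y")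
    case True
    have "(h has_derivative (*) (h' z)) (at z within {x..y})" if "x \<le> z" "z \<le> y" for z
      using d[of z] that \<open>x \<in> Z\<close> \<open>y \<in> Z\<close>
      by (auto simp: has_field_derivative_def Z_def intro: has_derivative_subset)
    from mvt_simple[OF True this] obtain z where z: "z \<in> {x<..<y}" "h y - h x = h' z * (y - x)"
      by blast
    have "\<bar>h' z\<bar> \<ge> \<Lambda>"
      using z(1) that by (intro lower) (auto simp: Z_def)
    then have "\<Lambda> * (y - x) \<le> \<bar>h y - h x\<bar>"
      using True z(2) by (simp add: abs_mult mult_right_mono)
    also have "\<dots> \<le> \<Lambda> * (2 * \<epsilon>)"
      using that by (auto simp: Z_def)
    finally show ?thesis
      using \<open>\<Lambda> > 0\<close> by simp
  next
    case False
    then show ?thesis using \<open>\<epsilon> > 0\<close> by simp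
  qed
  show thesis
  proof (cases "Z = {}")
    case True
    \<comment> \<open>Without small values the middle piece degenerates to the point
      \<open>a\<close>, and the right piece is the whole open interval.\<close>
    show thesis
      by (rule that[of a a]) (use True assms in \<open>auto simp: Z_def not_less\<close>)
  next
    case False
    have bdd: "bdd_below Z" "bdd_above Z"
      by (auto simp: Z_def intro: bdd_belowI[of _ a] bdd_aboveI[of _ b])
    have "Sup Z \<le> Inf Z + 2 * \<epsilon>"
    proof (rule cSup_least[OF False])
      fix y assume "y \<in> Z"
      have "y - 2 * \<epsilon> \<le> Inf Z"
        by (rule cInf_greatest[OF False]) (use close[OF _ \<open>y \<in> Z\<close>] in fastforce)
      then show "y \<le> Inf Z + 2 * \<epsilon>" by simp
    qed
    moreover have "a \<le> Inf Z" "Sup Z \<le> b"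
      by (rule cInf_greatest[OF False] cSup_least[OF False]; simp add: Z_def)+
    moreover have "Inf Z \<le> Sup Z"
      by (rule cInf_le_cSup[OF False bdd(2) bdd(1)])
    moreover have "\<bar>h y\<bar> \<ge> \<Lambda> * \<epsilon>" if "y \<in> {a<..<Inf Z} \<or> y \<in> {Sup Z<..<b}" for y
    proof (rule ccontr)
      assume "\<not> ?thesis"
      with that calculation have "y \<in> Z" by (auto simp: Z_def)
      then show False
        using that cInf_lower[OF _ bdd(1)] cSup_upper[OF _ bdd(2)] by fastforce
    qed
    ultimately show thesis
      by (intro that[of "Inf Z" "Sup Z"]) auto
  qed
qed

text \<open>Where \<open>h\<close> is small the integral is bounded by the length of the interval. The threshold \<open>\<Lambda> \<epsilon>\<close>
  balances this contribution \<open>2 \<epsilon>\<close> against the two outer ones \<open>C (\<Lambda> \<epsilon>)\<^bsup>-1/q\<^esup>\<close>.\<close>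

lemma van_der_corput_step:
  fixes h h' \<phi> :: "real \<Rightarrow> real"
  assumes "a \<le> b" "\<Lambda> > 0" "q > 0" "C > 0"
    and cont: "continuous_on {a..b} \<phi>"
    and d: "\<And>y. y \<in> {a..b} \<Longrightarrow> (h has_real_derivative h' y) (at y within {a..b})"
    and lower: "\<And>y. y \<in> {a<..<b} \<Longrightarrow> \<bar>h' y\<bar> \<ge> \<Lambda>"
    and IH: "\<And>c d \<mu>. a \<le> c \<Longrightarrow> c \<le> d \<Longrightarrow> d \<le> b \<Longrightarrow> \<mu> > 0 \<Longrightarrow>
      (\<And>y. y \<in> {c<..<d} \<Longrightarrow> \<bar>h y\<bar> \<ge> \<mu>) \<Longrightarrow>
      norm (integral {c..d} (\<lambda>y. cis (\<phi> y))) \<le> C * \<mu> powr (- 1 / real q)"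
  shows "norm (integral {a..b} (\<lambda>y. cis (\<phi> y))) \<le> (2 * C + 2) * \<Lambda> powr (- 1 / real (Suc q))"
proof -
  define \<epsilon> where "\<epsilon> = \<Lambda> powr (- 1 / real (Suc q))"
  have "\<epsilon> > 0" using \<open>\<Lambda> > 0\<close> by (simp add: \<epsilon>_def)
  obtain c d where cd: "a \<le> c" "c \<le> d" "d \<le> b" "d - c \<le> 2 * \<epsilon>"
    "\<And>y. y \<in> {a<..<c} \<Longrightarrow> \<bar>h y\<bar> \<ge> \<Lambda> * \<epsilon>" "\<And>y. y \<in> {d<..<b} \<Longrightarrow> \<bar>h y\<bar> \<ge> \<Lambda> * \<epsilon>"
    using small_values_in_short_interval[of a b \<epsilon> \<Lambda> h h'] assms \<open>\<epsilon> > 0\<close> by metis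
  \<comment> \<open>As \<open>\<Lambda> \<epsilon>\<close> is \<open>\<Lambda>\<close> to the power
    \<open>q / (q + 1)\<close>, each outer piece costs \<open>C \<epsilon>\<close>. With
    \<open>2 \<epsilon>\<close> for the middle piece the total is
    \<open>(2 C + 2) \<epsilon>\<close>.\<close>
  have balance: "(\<Lambda> * \<epsilon>) powr (- 1 / real q) = \<epsilon>"
  proof -
    have "\<Lambda> * \<epsilon> = \<Lambda> powr (1 - 1 / real (Suc q))"
      using \<open>\<Lambda> > 0\<close> by (simp add: \<epsilon>_def powr_diff powr_minus_divide)
    moreover have "(1 - 1 / real (Suc q)) * (- 1 / real q) = - 1 / real (Suc q)"
      using \<open>q > 0\<close> by (simp add: field_simps)
    ultimately show ?thesis
      by (simp add: \<epsilon>_def powr_powr)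
  qed
  let ?f = "\<lambda>y. cis (\<phi> y)"
  have cf: "continuous_on {a..b} ?f" by (intro continuous_intros cont)
  have int: "?f integrable_on {x..y}" if "a \<le> x" "y \<le> b" for x y
    using cf that by (intro integrable_continuous_real) (auto elim: continuous_on_subset)
  have combine: "integral {a..b} ?f = integral {a..c} ?f + integral {c..d} ?f + integral {d..b} ?f"
    using cd int by (simp add: Henstock_Kurzweil_Integration.integral_combine)
  have "norm (integral {a..b} ?f)
    \<le> norm (integral {a..c} ?f) + norm (integral {c..d} ?f) + norm (integral {d..b} ?f)"
    unfolding combine
    using norm_triangle_ineq[of "integral {a..c} ?f" "integral {c..d} ?f"]
      norm_triangle_ineq[of "integral {a..c} ?f + integral {c..d} ?f" "integral {d..b} ?f"]
    by linarith
  moreover have "norm (integral {c..d} ?f) \<le> 1 * (d - c)"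
    using cd by (intro integral_bound continuous_on_subset[OF cf]) auto
  moreover have "norm (integral {a..c} ?f) \<le> C * \<epsilon>" "norm (integral {d..b} ?f) \<le> C * \<epsilon>"
    using IH[of a c "\<Lambda> * \<epsilon>", unfolded balance] IH[of d b "\<Lambda> * \<epsilon>", unfolded balance]
      cd \<open>\<epsilon> > 0\<close> \<open>\<Lambda> > 0\<close> by auto
  ultimately have "norm (integral {a..b} ?f) \<le> (2 * C + 2) * \<epsilon>"
    using cd(4) by (simp add: algebra_simps)
  then show ?thesis by (simp add: \<epsilon>_def)
qed

text \<open>A change of sign would produce a zero by connectedness of the image. The factor
  \<open>\<sigma>\<close> is the form of the sign that \<open>van_der_corput_first\<close>
  takes.\<close>

lemma constant_sign:
  fixes f :: "real \<Rightarrow> real"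
  assumes "continuous_on {a..b} f" "\<And>y. y \<in> {a..b} \<Longrightarrow> f y \<noteq> 0"
  obtains \<sigma> where "\<bar>\<sigma>\<bar> = 1" "\<And>y. y \<in> {a..b} \<Longrightarrow> \<bar>f y\<bar> = \<sigma> * f y"
proof (cases "\<exists>x\<in>{a..b}. f x < 0")
  case False
  show thesis
    by (rule that[of 1]) (use False in \<open>auto simp: not_less\<close>)
next
  case True
  then obtain x where x: "x \<in> {a..b}" "f x < 0" by blast
  have conn: "connected (f ` {a..b})"
    by (intro connected_continuous_image assms) auto
  have "f y \<le> 0" if "y \<in> {a..b}" for y
  proof (rule ccontr)
    assume "\<not> f y \<le> 0"
    then have "0 \<in> f ` {a..b}"
      using connectedD_interval[OF conn, of "f x" "f y" 0] x that by auto
    then show False using assms(2) by fastforce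
  qed
  then show thesis
    by (intro that[of "-1"]) auto
qed

text \<open>The phase is \<open>D 0\<close> and \<open>D n\<close> is its \<open>n\<close>-th
  derivative. Passing the derivatives as a family lets the phase be restricted to subintervals
  without recomputing them. One \<open>C\<close> serves all phases, intervals and
  \<open>\<Lambda>\<close>, which is the source of the uniformity in \<open>x\<close>,
  \<open>t\<close>, \<open>\<delta>\<close> and \<open>k\<close>.\<close>

definition van_der_corput_const :: "nat \<Rightarrow> real \<Rightarrow> bool" where
  "van_der_corput_const p C \<longleftrightarrow> C > 0 \<and>
    (\<forall>(D :: nat \<Rightarrow> real \<Rightarrow> real) a b \<Lambda>. a \<le> b \<longrightarrow> \<Lambda> > 0 \<longrightarrow>
      (\<forall>n<p. \<forall>y\<in>{a..b}. (D n has_real_derivative D (Suc n) y) (at y within {a..b})) \<longrightarrow>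
      continuous_on {a..b} (D p) \<longrightarrow> (\<forall>y\<in>{a<..<b}. \<bar>D p y\<bar> \<ge> \<Lambda>) \<longrightarrow>
      norm (integral {a..b} (\<lambda>y. cis (D 0 y))) \<le> C * \<Lambda> powr (- 1 / real p))"

lemma van_der_corput_constD:
  assumes "van_der_corput_const p C" "a \<le> b" "\<Lambda> > 0"
    and "\<And>n y. n < p \<Longrightarrow> y \<in> {a..b} \<Longrightarrow> (D n has_real_derivative D (Suc n) y) (at y within {a..b})"
    and "continuous_on {a..b} (D p)" "\<And>y. y \<in> {a<..<b} \<Longrightarrow> \<bar>D p y\<bar> \<ge> \<Lambda>"
  shows "norm (integral {a..b} (\<lambda>y. cis (D 0 y))) \<le> C * \<Lambda> powr (- 1 / real p)"
  using assms(2-)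
  by (intro assms(1)[unfolded van_der_corput_const_def, THEN conjunct2, rule_format, of a b \<Lambda> D]) auto

text \<open>Induction on \<open>p\<close>, with \<open>h = D p\<close> in the step. A lower bound on
  the first derivative alone does not suffice, so the induction starts at 2: there the continuous
  second derivative has constant sign, and the first-derivative estimate applies on each outer
  piece.\<close>

lemma van_der_corput:
  assumes "p \<ge> 2"
  shows "\<exists>C. van_der_corput_const p C"
  using assms
proof (induction p rule: dec_induct)
  case base
  \<comment> \<open>The constant is \<open>10 = 2 * 4 + 2\<close>, from the step with
    \<open>q = 1\<close> and \<open>C = 4\<close>.\<close>
  have "norm (integral {a..b} (\<lambda>y. cis (D 0 y))) \<le> 10 * \<Lambda> powr (- 1 / real 2)"
    if "a \<le> b" "\<Lambda> > 0"
      and D: "\<forall>n<2. \<forall>y\<in>{a..b}. (D n has_real_derivative D (Suc n) y) (at y within {a..b})"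
      and cont: "continuous_on {a..b} (D 2)"
      and lower: "\<forall>y\<in>{a<..<b}. \<bar>D 2 y\<bar> \<ge> \<Lambda>"
    for D :: "nat \<Rightarrow> real \<Rightarrow> real" and a b \<Lambda>
  proof (cases "a = b")
    case True
    then show ?thesis by simp
  next
    case False
    with \<open>a \<le> b\<close> have "a < b" by simp
    have "D 2 y \<noteq> 0" if "y \<in> {a..b}" for y
      using abs_ge_on_Icc[OF cont _ \<open>a < b\<close> that, of \<Lambda>] lower \<open>\<Lambda> > 0\<close> by fastforce
    from constant_sign[OF cont this] obtain \<sigma>
      where \<sigma>: "\<bar>\<sigma>\<bar> = 1" "\<And>y. y \<in> {a..b} \<Longrightarrow> \<bar>D 2 y\<bar> = \<sigma> * D 2 y"
      by blast
    have d: "(D 0 has_real_derivative D 1 y) (at y within {a..b})"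
      "(D 1 has_real_derivative D 2 y) (at y within {a..b})" if "y \<in> {a..b}" for y
      using D[rule_format, of 0 y] D[rule_format, of 1 y] that by (simp_all add: numeral_2_eq_2)
    have first: "norm (integral {c..e} (\<lambda>y. cis (D 0 y))) \<le> 4 * \<mu> powr (- 1 / real 1)"
      if "a \<le> c" "c \<le> e" "e \<le> b" "\<mu> > 0" "\<And>y. y \<in> {c<..<e} \<Longrightarrow> \<bar>D 1 y\<bar> \<ge> \<mu>" for c e \<mu>
    proof -
      have "norm (integral {c..e} (\<lambda>y. cis (D 0 y))) \<le> 4 / \<mu>"
        using that \<sigma>
        by (intro van_der_corput_first[of c e \<mu> "D 0" "D 1" "D 2" \<sigma>] DERIV_subset[OF d(1)]
            DERIV_subset[OF d(2)]) auto
      then show ?thesis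
        using \<open>\<mu> > 0\<close> by (simp add: powr_minus_divide)
    qed
    have "norm (integral {a..b} (\<lambda>y. cis (D 0 y))) \<le> (2 * 4 + 2) * \<Lambda> powr (- 1 / real (Suc 1))"
    proof (rule van_der_corput_step[where h = "D 1" and h' = "D 2"])
      show "continuous_on {a..b} (D 0)"
        by (rule DERIV_continuous_on) (erule d(1))
    qed (use \<open>a \<le> b\<close> \<open>\<Lambda> > 0\<close> d(2) lower first in auto)
    then show ?thesis by simp
  qed
  then show ?case
    unfolding van_der_corput_const_def by (intro exI[of _ 10]) auto
next
  case (step p)
  then obtain C where C: "van_der_corput_const p C" by blast
  then have "C > 0" by (simp add: van_der_corput_const_def)
  have "norm (integral {a..b} (\<lambda>y. cis (D 0 y))) \<le> (2 * C + 2) * \<Lambda> powr (- 1 / real (Suc p))"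
    if "a \<le> b" "\<Lambda> > 0"
      and D: "\<forall>n<Suc p. \<forall>y\<in>{a..b}. (D n has_real_derivative D (Suc n) y) (at y within {a..b})"
      and lower: "\<forall>y\<in>{a<..<b}. \<bar>D (Suc p) y\<bar> \<ge> \<Lambda>"
    for D :: "nat \<Rightarrow> real \<Rightarrow> real" and a b \<Lambda>
  proof (rule van_der_corput_step[where h = "D p" and h' = "D (Suc p)"])
    \<comment> \<open>Differentiability of \<open>D p\<close> supplies the continuity that the
      induction hypothesis asks for at order \<open>p\<close>.\<close>
    have cont: "continuous_on {a..b} (D n)" if "n < Suc p" for n
      by (rule DERIV_continuous_on[of _ _ "D (Suc n)"]) (use D that in blast)
    then show "continuous_on {a..b} (D 0)" by simp
    show "norm (integral {c..e} (\<lambda>y. cis (D 0 y))) \<le> C * \<mu> powr (- 1 / real p)"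
      if "a \<le> c" "c \<le> e" "e \<le> b" "\<mu> > 0" "\<And>y. y \<in> {c<..<e} \<Longrightarrow> \<bar>D p y\<bar> \<ge> \<mu>" for c e \<mu>
    proof (rule van_der_corput_constD[OF C])
      show "(D n has_real_derivative D (Suc n) y) (at y within {c..e})"
        if "n < p" "y \<in> {c..e}" for n y
        using D[rule_format, of n y] that \<open>a \<le> c\<close> \<open>e \<le> b\<close>
        by (auto elim: DERIV_subset)
      show "continuous_on {c..e} (D p)"
        using \<open>a \<le> c\<close> \<open>e \<le> b\<close> by (intro continuous_on_subset[OF cont]) auto
    qed (use that in auto)
  qed (use that \<open>C > 0\<close> \<open>2 \<le> p\<close> in auto)
  then show ?case
    using \<open>C > 0\<close> unfolding van_der_corput_const_def by (intro exI[of _ "2 * C + 2"]) auto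
qed

section \<open>Oscillatory integrals with an amplitude\<close>

text \<open>Integration by parts with the primitive \<open>F\<close> of \<open>f\<close> that
  vanishes at \<open>a\<close>. The bound \<open>B\<close> on all initial segments is a bound on
  \<open>F\<close>, so the boundary term costs \<open>B * norm (\<psi> b)\<close> and the remaining
  integral \<open>B * K * (b - a)\<close>.\<close>

lemma integral_amplitude_bound:
  fixes f \<psi> \<psi>' :: "real \<Rightarrow> complex"
  assumes "a \<le> b" "continuous_on {a..b} f" "continuous_on {a..b} \<psi>'"
    and d: "\<And>y. y \<in> {a..b} \<Longrightarrow> (\<psi> has_vector_derivative \<psi>' y) (at y within {a..b})"
    and B: "\<And>c. c \<in> {a..b} \<Longrightarrow> norm (integral {a..c} f) \<le> B"
    and K: "\<And>y. y \<in> {a..b} \<Longrightarrow> norm (\<psi>' y) \<le> K"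
  shows "norm (integral {a..b} (\<lambda>y. f y * \<psi> y)) \<le> B * (norm (\<psi> b) + K * (b - a))"
proof -
  define F where "F c = integral {a..c} f" for c
  have dF: "(F has_vector_derivative f y) (at y within {a..b})" if "y \<in> {a..b}" for y
    unfolding F_def by (rule integral_has_vector_derivative[OF assms(2) that])
  have "F a = 0" by (simp add: F_def)
  have cF: "continuous_on {a..b} F"
    by (rule continuous_on_vector_derivative) (erule dF)
  have ftc: "((\<lambda>y. F y * \<psi>' y + f y * \<psi> y) has_integral (F b * \<psi> b - F a * \<psi> a)) {a..b}"
    by (rule fundamental_theorem_of_calculus[OF \<open>a \<le> b\<close>])
      (intro has_vector_derivative_mult dF d)
  have "(\<lambda>y. F y * \<psi>' y) integrable_on {a..b}"
    by (intro integrable_continuous_real continuous_intros cF assms)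
  then have "((\<lambda>y. f y * \<psi> y) has_integral (F b * \<psi> b - integral {a..b} (\<lambda>y. F y * \<psi>' y))) {a..b}"
    using has_integral_diff[OF ftc integrable_integral, of "\<lambda>y. F y * \<psi>' y"] by (simp add: \<open>F a = 0\<close>)
  then have eq: "integral {a..b} (\<lambda>y. f y * \<psi> y) = F b * \<psi> b - integral {a..b} (\<lambda>y. F y * \<psi>' y)"
    by (rule integral_unique)
  have FB: "norm (F y) \<le> B" if "y \<in> {a..b}" for y
    using B[OF that] by (simp add: F_def)
  have "B \<ge> 0"
    using B[of a] \<open>a \<le> b\<close> by simp
  have "norm (integral {a..b} (\<lambda>y. F y * \<psi>' y)) \<le> (B * K) * (b - a)"
  proof (rule integral_bound[OF \<open>a \<le> b\<close>])
    show "continuous_on {a..b} (\<lambda>y. F y * \<psi>' y)"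
      by (intro continuous_intros cF assms)
    show "norm (F y * \<psi>' y) \<le> B * K" if "y \<in> {a..b}" for y
      using FB[OF that] K[OF that] \<open>B \<ge> 0\<close> by (simp add: norm_mult mult_mono)
  qed
  moreover have "norm (F b * \<psi> b) \<le> B * norm (\<psi> b)"
    using FB[of b] \<open>a \<le> b\<close> by (simp add: norm_mult mult_right_mono)
  ultimately show ?thesis
    unfolding eq using norm_triangle_ineq4[of "F b * \<psi> b" "integral {a..b} (\<lambda>y. F y * \<psi>' y)"]
    by (simp add: algebra_simps)
qed

section \<open>Derivatives within a set and reduction to a dyadic interval\<close>

lemma Cn_on_imp_has_vector_derivative:
  assumes "Cn_on n f S" "m < n" "y \<in> S" "T \<subseteq> S"
  shows "(nth_deriv S m f has_vector_derivative nth_deriv S (Suc m) f y) (at y within T)"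
proof -
  have "nth_deriv S m f differentiable (at y within S)"
    using assms by (auto simp: Cn_on_def)
  then have "(nth_deriv S m f has_vector_derivative nth_deriv S (Suc m) f y) (at y within S)"
    by (simp add: vector_derivative_works)
  then show ?thesis
    by (rule has_vector_derivative_within_subset) fact
qed

text \<open>The logarithms of \<open>y\<close> and \<open>N\<close> differ by at most
  \<open>ln 2\<close>, so the powers differ by a factor of at most
  \<open>2 powr \<bar>\<alpha>\<bar>\<close>, for either sign of \<open>\<alpha>\<close>.\<close>

lemma powr_ge_dyadic:
  fixes N y :: real
  assumes "N > 0" "N / 2 \<le> y" "y \<le> 2 * N"
  shows "y powr \<alpha> \<ge> 2 powr (- \<bar>\<alpha>\<bar>) * N powr \<alpha>"
proof -
  have "y > 0" using assms by simp
  have "ln (N / 2) \<le> ln y" "ln y \<le> ln (2 * N)"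
    using assms \<open>y > 0\<close> by simp_all
  then have "\<bar>ln y - ln N\<bar> \<le> ln 2"
    using assms by (simp add: ln_div ln_mult abs_le_iff)
  then have "\<bar>\<alpha> * (ln y - ln N)\<bar> \<le> \<bar>\<alpha>\<bar> * ln 2"
    by (simp add: abs_mult mult_left_mono)
  then have "- \<bar>\<alpha>\<bar> * ln 2 + \<alpha> * ln N \<le> \<alpha> * ln y"
    by (simp add: algebra_simps abs_le_iff)
  then show ?thesis
    using assms \<open>y > 0\<close> by (simp add: powr_def flip: exp_add)
qed

lemma mem_dyadic_indices_iff:
  "k \<in> dyadic_indices J \<longleftrightarrow> {2 powi k / 2..2 * 2 powi k} \<subseteq> J"
  by (simp add: dyadic_indices_def power_int_add power_int_diff mult.commute)

text \<open>The support of \<open>P\<close> confines \<open>\<xi>\<close> to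
  \<open>[M/2, 2M]\<close>. With \<open>M powr s\<close> factored out, the amplitude is a fixed
  function of \<open>\<xi> / M\<close>, so its bounds do not depend on \<open>k\<close> or
  \<open>\<delta>\<close>. The Lebesgue integral becomes a gauge integral, to which the preceding
  estimates apply.\<close>

lemma osc_int_eq_integral:
  fixes P :: "real \<Rightarrow> complex" and k :: int
  assumes P: "continuous_on {1/2..2} P" "{y. P y \<noteq> 0} \<subseteq> {y. 1/2 \<le> \<bar>y\<bar> \<and> \<bar>y\<bar> \<le> 2}"
    and g: "continuous_on {2 powi k / 2..2 * 2 powi k} g" and "\<delta> > 0"
    and M: "M = 2 powi k / \<delta>"
  shows "continuous_on {M / 2..2 * M} (\<lambda>\<xi>. x * \<xi> + t / \<delta> * g (\<delta> * \<xi>))"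
    and "osc_int g P \<delta> s t x k = integral {M / 2..2 * M}
      (\<lambda>\<xi>. cis (x * \<xi> + t / \<delta> * g (\<delta> * \<xi>)) * (of_real (M powr s) * (P (\<xi> / M) * of_real ((\<xi> / M) powr s))))"
proof -
  have "M > 0" using \<open>\<delta> > 0\<close> by (simp add: M)
  let ?\<phi> = "\<lambda>\<xi>. x * \<xi> + t / \<delta> * g (\<delta> * \<xi>)"
  let ?F = "\<lambda>\<xi>. cis (?\<phi> \<xi>) * (of_real (M powr s) * (P (\<xi> / M) * of_real ((\<xi> / M) powr s)))"
  have "continuous_on {M / 2..2 * M} (\<lambda>\<xi>. g (\<delta> * \<xi>))"
    by (rule continuous_on_compose2[OF g])
      (use \<open>\<delta> > 0\<close> in \<open>auto intro!: continuous_intros simp: M field_simps\<close>)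
  then show c\<phi>: "continuous_on {M / 2..2 * M} ?\<phi>"
    by (intro continuous_intros)
  have cP: "continuous_on {M / 2..2 * M} (\<lambda>\<xi>. P (\<xi> / M))"
    by (rule continuous_on_compose2[OF P(1)])
      (use \<open>M > 0\<close> in \<open>auto intro!: continuous_intros simp: field_simps\<close>)
  have cF: "continuous_on {M / 2..2 * M} ?F"
    using \<open>M > 0\<close> by (intro continuous_intros c\<phi> cP) auto
  have "osc_int g P \<delta> s t x k = (LINT \<xi>:{M / 2..2 * M}|lborel. ?F \<xi>)"
    unfolding osc_int_def set_lebesgue_integral_def
  proof (rule Bochner_Integration.integral_cong[OF refl])
    fix \<xi> :: real
    have arg: "\<delta> * \<xi> / 2 powi k = \<xi> / M"
      by (simp add: M)
    show "indicator {0<..} \<xi> *\<^sub>R (exp (\<i> * of_real (x * \<xi>)) * exp (\<i> * of_real (t / \<delta> * g (\<delta> * \<xi>)))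
        * P (\<delta> * \<xi> / 2 powi k) * of_real (\<xi> powr s)) = indicator {M / 2..2 * M} \<xi> *\<^sub>R ?F \<xi>"
    \<comment> \<open>In the second case both sides vanish: either \<open>P\<close> is zero at the
      argument, or \<open>\<xi> \<le> 0\<close> lies in neither domain of integration.\<close>
    proof (cases "\<xi> > 0 \<and> P (\<xi> / M) \<noteq> 0")
      case True
      then have "\<xi> \<in> {M / 2..2 * M}"
        using subsetD[OF P(2), of "\<xi> / M"] \<open>M > 0\<close> by (simp add: field_simps)
      moreover have "\<xi> powr s = M powr s * (\<xi> / M) powr s"
        using True \<open>M > 0\<close> by (simp add: powr_divide)
      ultimately show ?thesis
        using True unfolding arg
        by (simp add: cis_conv_exp exp_add ring_distribs mult_ac flip: of_real_mult)
    next
      case False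
      moreover have "\<xi> > 0" if "\<xi> \<in> {M / 2..2 * M}"
        using that \<open>M > 0\<close> by auto
      ultimately show ?thesis
        unfolding arg by (auto simp: indicator_def)
    qed
  qed
  also have "\<dots> = integral {M / 2..2 * M} ?F"
    by (rule set_borel_integral_eq_integral[OF borel_integrable_atLeastAtMost'[OF cF]])
  finally show "osc_int g P \<delta> s t x k = integral {M / 2..2 * M} ?F" .
qed

section \<open>Uniform estimates of the oscillatory integral\<close>

text \<open>The interval stays away from 0, so \<open>P y * y powr s\<close> is continuously
  differentiable there, and compactness bounds it and its derivative by one \<open>K\<close>
  depending only on \<open>P\<close> and \<open>s\<close>.\<close>

lemma amplitude_bounds:
  fixes P :: "real \<Rightarrow> complex" and s :: real
  assumes P: "Cn_on 1 P UNIV"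
  obtains K \<eta>' where "K > 0" "continuous_on {1/2..2} \<eta>'"
    "\<forall>y\<in>{1/2..2}.
      ((\<lambda>y. P y * of_real (y powr s)) has_vector_derivative \<eta>' y) (at y within {1/2..2})"
    "\<forall>y\<in>{1/2..2}. norm (P y * of_real (y powr s)) \<le> K"
    "\<forall>y\<in>{1/2..2}. norm (\<eta>' y) \<le> K"
proof -
  define \<eta> where "\<eta> y = P y * of_real (y powr s)" for y
  define \<eta>' where "\<eta>' y = P y * of_real (s * y powr (s - 1)) + nth_deriv UNIV 1 P y * of_real (y powr s)" for y
  have dP: "(P has_vector_derivative nth_deriv UNIV 1 P y) (at y within T)" for y T
    using Cn_on_imp_has_vector_derivative[OF P, of 0 y T] by simp
  have cP: "continuous_on {1/2..2} P"
    by (rule continuous_on_vector_derivative[OF dP])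
  have cP': "continuous_on {1/2..2} (nth_deriv UNIV 1 P)"
    using P by (auto simp: Cn_on_def intro: continuous_on_subset)
  have c: "continuous_on {1/2..2} \<eta>'"
    unfolding \<eta>'_def by (intro continuous_intros cP cP') auto
  have c0: "continuous_on {1/2..2} \<eta>"
    unfolding \<eta>_def by (intro continuous_intros cP) auto
  have d: "(\<eta> has_vector_derivative \<eta>' y) (at y within {1/2..2})" if "y \<in> {1/2..2}" for y
  proof -
    have "((\<lambda>y. y powr s) has_real_derivative s * y powr (s - 1)) (at y within {1/2..2})"
      using that by (intro has_field_derivative_at_within[OF has_real_derivative_powr]) auto
    then have "((\<lambda>y. complex_of_real (y powr s)) has_vector_derivative of_real (s * y powr (s - 1)))
        (at y within {1/2..2})"
      by (intro has_vector_derivative_of_real) (simp add: has_real_derivative_iff_has_vector_derivative)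
    from has_vector_derivative_mult[OF dP this] show ?thesis
      unfolding \<eta>_def \<eta>'_def .
  qed
  have "bounded (\<eta> ` {1/2..2} \<union> \<eta>' ` {1/2..2})"
    by (intro bounded_Un[THEN iffD2] conjI compact_imp_bounded compact_continuous_image c c0) auto
  then obtain K where "K > 0" "\<forall>z \<in> \<eta> ` {1/2..2} \<union> \<eta>' ` {1/2..2}. norm z \<le> K"
    using bounded_pos by blast
  with c d show thesis
    by (intro that) (auto simp: \<eta>_def[abs_def])
qed

text \<open>Supremum \<open>M powr s * K\<close> of the integrand times the length
  \<open>3/2 * M\<close> of the interval. This covers the range of parameters where oscillation
  gains nothing.\<close>

lemma osc_int_trivial_bound:
  fixes P :: "real \<Rightarrow> complex" and s :: real
  assumes P: "Cn_on 1 P UNIV" "{y. P y \<noteq> 0} \<subseteq> {y. 1/2 \<le> \<bar>y\<bar> \<and> \<bar>y\<bar> \<le> 2}"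
  obtains C where "C > 0"
    "\<And>g \<delta> t x k. continuous_on {2 powi k / 2..2 * 2 powi k} g \<Longrightarrow> \<delta> > 0 \<Longrightarrow>
      norm (osc_int g P \<delta> s t x k) \<le> C * (2 powi k / \<delta>) powr (s + 1)"
proof -
  obtain K \<eta>' where K: "K > 0" "continuous_on {1/2..2} \<eta>'" "\<forall>y\<in>{1/2..2}.
      ((\<lambda>y. P y * of_real (y powr s)) has_vector_derivative \<eta>' y) (at y within {1/2..2})"
    "\<forall>y\<in>{1/2..2}. norm (P y * of_real (y powr s)) \<le> K"
    "\<forall>y\<in>{1/2..2}. norm (\<eta>' y) \<le> K"
    by (rule amplitude_bounds[OF P(1), of s])
  have cP: "continuous_on T P" for T
    using Cn_on_imp_has_vector_derivative[OF P(1), of 0]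
    by (intro continuous_on_vector_derivative[of _ _ "nth_deriv UNIV 1 P"]) auto
  have "norm (osc_int g P \<delta> s t x k) \<le> (3 / 2 * K) * (2 powi k / \<delta>) powr (s + 1)"
    if g: "continuous_on {2 powi k / 2..2 * 2 powi k} g" and "\<delta> > 0"
    for g \<delta> t x and k :: int
  proof -
    define M where "M = 2 powi k / \<delta>"
    have "M > 0" using \<open>\<delta> > 0\<close> by (simp add: M_def)
    note rep = osc_int_eq_integral[OF cP P(2) g \<open>\<delta> > 0\<close> M_def]
    have scaled: "\<xi> / M \<in> {1/2..2}" if "\<xi> \<in> {M / 2..2 * M}" for \<xi>
      using that \<open>M > 0\<close> by (simp add: field_simps)
    have "norm (osc_int g P \<delta> s t x k) \<le> (M powr s * K) * (2 * M - M / 2)"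
      unfolding rep(2)
    proof (rule integral_bound)
      have "continuous_on {M / 2..2 * M} (\<lambda>\<xi>. P (\<xi> / M))"
        by (rule continuous_on_compose2[OF cP[of UNIV]]) (use \<open>M > 0\<close> in \<open>auto intro!: continuous_intros\<close>)
      then show "continuous_on {M / 2..2 * M} (\<lambda>\<xi>. cis (x * \<xi> + t / \<delta> * g (\<delta> * \<xi>)) *
          (of_real (M powr s) * (P (\<xi> / M) * of_real ((\<xi> / M) powr s))))"
        using \<open>M > 0\<close> by (intro continuous_intros rep(1)) auto
      show "norm (cis (x * \<xi> + t / \<delta> * g (\<delta> * \<xi>)) *
          (of_real (M powr s) * (P (\<xi> / M) * of_real ((\<xi> / M) powr s)))) \<le> M powr s * K"
        if "\<xi> \<in> {M / 2..2 * M}" for \<xi>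
        using bspec[OF K(4) scaled[OF that]] by (simp add: norm_mult mult_left_mono)
    qed (use \<open>M > 0\<close> in auto)
    also have "\<dots> = (3 / 2 * K) * M powr (s + 1)"
      using \<open>M > 0\<close> by (simp add: powr_add)
    finally show ?thesis by (simp add: M_def)
  qed
  then show thesis
    using K(1) by (intro that[of "3 / 2 * K"]) auto
qed

text \<open>Van der Corput on initial segments of \<open>[M/2, 2M]\<close>, then integration by
  parts against the amplitude. The set \<open>S\<close> in which derivatives are taken is kept
  general, because the two claims use \<open>J \<inter> {0<..}\<close> and \<open>{0<..}\<close>
  respectively.\<close>

lemma osc_int_van_der_corput_bound:
  fixes P :: "real \<Rightarrow> complex" and s \<alpha> lam :: real
  assumes P: "Cn_on 1 P UNIV" "{y. P y \<noteq> 0} \<subseteq> {y. 1/2 \<le> \<bar>y\<bar> \<and> \<bar>y\<bar> \<le> 2}"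
    and "p \<ge> 2" "lam > 0"
  obtains C where "C > 0"
    "\<And>g S \<delta> t x k. Cn_on p g S \<Longrightarrow> {2 powi k / 2..2 * 2 powi k} \<subseteq> S \<Longrightarrow>
      (\<And>y. y \<in> {2 powi k / 2..2 * 2 powi k} \<Longrightarrow> \<bar>nth_deriv S p g y\<bar> \<ge> lam * y powr \<alpha>) \<Longrightarrow>
      t \<noteq> 0 \<Longrightarrow> \<delta> > 0 \<Longrightarrow>
      norm (osc_int g P \<delta> s t x k)
        \<le> C * ((2 powi k / \<delta>) powr s * (\<bar>t\<bar> * \<delta> powr (real p - 1) * (2 powi k) powr \<alpha>) powr (- 1 / real p))"
proof -
  obtain Cp where Cp: "van_der_corput_const p Cp"
    using van_der_corput[OF \<open>p \<ge> 2\<close>] by blast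
  then have "Cp > 0" by (simp add: van_der_corput_const_def)
  obtain K \<eta>' where K: "K > 0" "continuous_on {1/2..2} \<eta>'" "\<forall>y\<in>{1/2..2}.
      ((\<lambda>y. P y * of_real (y powr s)) has_vector_derivative \<eta>' y) (at y within {1/2..2})"
    "\<forall>y\<in>{1/2..2}. norm (P y * of_real (y powr s)) \<le> K"
    "\<forall>y\<in>{1/2..2}. norm (\<eta>' y) \<le> K"
    by (rule amplitude_bounds[OF P(1), of s])
  have cP: "continuous_on T P" for T
    using Cn_on_imp_has_vector_derivative[OF P(1), of 0]
    by (intro continuous_on_vector_derivative[of _ _ "nth_deriv UNIV 1 P"]) auto
  \<comment> \<open>The factor lost when \<open>y powr \<alpha>\<close> is replaced by its value at
    \<open>2 powi k\<close> on the dyadic interval.\<close>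
  define c where "c = lam * 2 powr (- \<bar>\<alpha>\<bar>)"
  have "c > 0" using \<open>lam > 0\<close> by (simp add: c_def)
  \<comment> \<open>The factor \<open>5/2 * K\<close> is \<open>K\<close> for the end-point value of
    the amplitude plus \<open>K / M\<close> times the length \<open>3/2 * M\<close>.\<close>
  define C where "C = Cp * c powr (- 1 / real p) * (5 / 2 * K)"
  have "norm (osc_int g P \<delta> s t x k)
      \<le> C * ((2 powi k / \<delta>) powr s * (\<bar>t\<bar> * \<delta> powr (real p - 1) * (2 powi k) powr \<alpha>) powr (- 1 / real p))"
    if g: "Cn_on p g S" and sub: "{2 powi k / 2..2 * 2 powi k} \<subseteq> S"
      and lower: "\<And>y. y \<in> {2 powi k / 2..2 * 2 powi k} \<Longrightarrow> \<bar>nth_deriv S p g y\<bar> \<ge> lam * y powr \<alpha>"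
      and "t \<noteq> 0" "\<delta> > 0"
    for g S \<delta> t x and k :: int
  proof -
    define N :: real where "N = 2 powi k"
    define M where "M = 2 powi k / \<delta>"
    have "N > 0" "M > 0" "N = \<delta> * M" using \<open>\<delta> > 0\<close> by (simp_all add: N_def M_def)
    have sub: "{N / 2..2 * N} \<subseteq> S" and lower: "\<And>y. y \<in> {N / 2..2 * N} \<Longrightarrow> \<bar>nth_deriv S p g y\<bar> \<ge> lam * y powr \<alpha>"
      using sub lower by (simp_all add: N_def)
    have dg: "(nth_deriv S n g has_real_derivative nth_deriv S (Suc n) g y) (at y within T)"
      if "n < p" "y \<in> S" "T \<subseteq> S" for n y T
      using Cn_on_imp_has_vector_derivative[OF g that]
      by (simp add: has_real_derivative_iff_has_vector_derivative)
    have img: "(*) \<delta> ` {M / 2..2 * M} \<subseteq> {N / 2..2 * N}"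
      using \<open>\<delta> > 0\<close> \<open>N = \<delta> * M\<close> by (auto simp: field_simps)
    have cg: "continuous_on {2 powi k / 2..2 * 2 powi k} g"
    proof (rule DERIV_continuous_on)
      show "(g has_real_derivative nth_deriv S (Suc 0) g y) (at y within {2 powi k / 2..2 * 2 powi k})"
        if "y \<in> {2 powi k / 2..2 * 2 powi k}" for y
        using dg[of 0 y "{N / 2..2 * N}"] that sub \<open>p \<ge> 2\<close> by (auto simp: N_def)
    qed
    note rep = osc_int_eq_integral[OF cP P(2) cg \<open>\<delta> > 0\<close> M_def]
    have scaled: "\<xi> / M \<in> {1/2..2}" if "\<xi> \<in> {M / 2..2 * M}" for \<xi>
      using that \<open>M > 0\<close> by (simp add: field_simps)
    define \<Lambda> where "\<Lambda> = \<bar>t\<bar> * \<delta> powr (real p - 1) * N powr \<alpha>"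
    have "\<Lambda> > 0" using \<open>t \<noteq> 0\<close> \<open>\<delta> > 0\<close> \<open>N > 0\<close> by (simp add: \<Lambda>_def)
    \<comment> \<open>The successive derivatives of the phase: the linear part contributes
      \<open>x * \<xi>\<close>, \<open>x\<close>, then 0, and each differentiation of the other part
      brings out a factor \<open>\<delta>\<close>.\<close>
    define D where "D n \<xi> = (if n = 0 then x * \<xi> else if n = 1 then x else 0)
        + t / \<delta> * \<delta> ^ n * nth_deriv S n g (\<delta> * \<xi>)" for n \<xi>
    have dD: "(D n has_real_derivative D (Suc n) \<xi>) (at \<xi> within {M / 2..2 * M})"
      if "n < p" "\<xi> \<in> {M / 2..2 * M}" for n \<xi>
    proof -
      have "(nth_deriv S n g \<circ> (*) \<delta> has_real_derivative nth_deriv S (Suc n) g (\<delta> * \<xi>) * \<delta>)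
          (at \<xi> within {M / 2..2 * M})"
      proof (rule DERIV_image_chain)
        show "(nth_deriv S n g has_real_derivative nth_deriv S (Suc n) g (\<delta> * \<xi>))
            (at (\<delta> * \<xi>) within (*) \<delta> ` {M / 2..2 * M})"
          using that img sub by (intro dg) (blast intro: subsetD)+
        show "((*) \<delta> has_real_derivative \<delta>) (at \<xi> within {M / 2..2 * M})"
          using DERIV_cmult_Id by blast
      qed
      then have "((\<lambda>\<xi>. t / \<delta> * \<delta> ^ n * nth_deriv S n g (\<delta> * \<xi>)) has_real_derivative
          t / \<delta> * \<delta> ^ n * (nth_deriv S (Suc n) g (\<delta> * \<xi>) * \<delta>)) (at \<xi> within {M / 2..2 * M})"
        unfolding o_def by (rule DERIV_cmult)
      moreover have "((\<lambda>\<xi>. if n = 0 then x * \<xi> else if n = 1 then x else 0) has_real_derivative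
          (if Suc n = 0 then x * \<xi> else if Suc n = 1 then x else 0)) (at \<xi> within {M / 2..2 * M})"
        by (cases "n = 0") (auto intro: DERIV_cmult_Id)
      ultimately have "((\<lambda>\<xi>. (if n = 0 then x * \<xi> else if n = 1 then x else 0)
          + t / \<delta> * \<delta> ^ n * nth_deriv S n g (\<delta> * \<xi>)) has_real_derivative
          (if Suc n = 0 then x * \<xi> else if Suc n = 1 then x else 0)
          + t / \<delta> * \<delta> ^ n * (nth_deriv S (Suc n) g (\<delta> * \<xi>) * \<delta>)) (at \<xi> within {M / 2..2 * M})"
        by (intro DERIV_add)
      moreover have "(if Suc n = 0 then x * \<xi> else if Suc n = 1 then x else 0)
          + t / \<delta> * \<delta> ^ n * (nth_deriv S (Suc n) g (\<delta> * \<xi>) * \<delta>) = D (Suc n) \<xi>"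
        by (simp add: D_def del: nth_deriv.simps)
      moreover have "(\<lambda>\<xi>. (if n = 0 then x * \<xi> else if n = 1 then x else 0)
          + t / \<delta> * \<delta> ^ n * nth_deriv S n g (\<delta> * \<xi>)) = D n"
        by (rule ext) (simp add: D_def)
      ultimately show ?thesis by metis
    qed
    \<comment> \<open>From order 2 on, \<open>x\<close> has disappeared; this makes the estimate
      uniform in \<open>x\<close>.\<close>
    have Dp: "D p = (\<lambda>\<xi>. t / \<delta> * \<delta> ^ p * nth_deriv S p g (\<delta> * \<xi>))"
      using \<open>p \<ge> 2\<close> by (auto simp: D_def)
    have cDp: "continuous_on {M / 2..2 * M} (D p)"
    proof -
      have "continuous_on S (nth_deriv S p g)"
        using g by (simp add: Cn_on_def)
      then have "continuous_on {M / 2..2 * M} (\<lambda>\<xi>. nth_deriv S p g (\<delta> * \<xi>))"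
        by (rule continuous_on_compose2) (use img sub in \<open>auto intro!: continuous_intros\<close>)
      then show ?thesis
        unfolding Dp by (intro continuous_intros)
    qed
    have lowerD: "\<bar>D p \<xi>\<bar> \<ge> c * \<Lambda>" if "\<xi> \<in> {M / 2..2 * M}" for \<xi>
    proof -
      have y: "\<delta> * \<xi> \<in> {N / 2..2 * N}" using that img by blast
      have "c * N powr \<alpha> \<le> lam * (\<delta> * \<xi>) powr \<alpha>"
        using powr_ge_dyadic[of N "\<delta> * \<xi>" \<alpha>] y \<open>N > 0\<close> \<open>lam > 0\<close> by (simp add: c_def)
      also have "\<dots> \<le> \<bar>nth_deriv S p g (\<delta> * \<xi>)\<bar>"
        by (rule lower[OF y])
      finally have "\<bar>t\<bar> * \<delta> powr (real p - 1) * (c * N powr \<alpha>)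
          \<le> \<bar>t\<bar> * \<delta> powr (real p - 1) * \<bar>nth_deriv S p g (\<delta> * \<xi>)\<bar>"
        by (rule mult_left_mono) simp
      moreover have "\<delta> powr (real p - 1) = \<delta> ^ p / \<delta>"
        using \<open>\<delta> > 0\<close> by (simp add: powr_diff powr_realpow)
      ultimately show ?thesis
        using \<open>\<delta> > 0\<close> by (simp add: Dp \<Lambda>_def abs_mult mult_ac)
    qed
    let ?\<phi> = "\<lambda>\<xi>. x * \<xi> + t / \<delta> * g (\<delta> * \<xi>)"
    define B where "B = Cp * (c * \<Lambda>) powr (- 1 / real p)"
    have D0: "D 0 = ?\<phi>" by (simp add: D_def fun_eq_iff)
    \<comment> \<open>All initial segments are treated, as the integration by parts needs a bound on
      the whole primitive.\<close>
    have B: "norm (integral {M / 2..e} (\<lambda>\<xi>. cis (?\<phi> \<xi>))) \<le> B" if "e \<in> {M / 2..2 * M}" for e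
      unfolding B_def D0[symmetric, THEN fun_cong]
    proof (rule van_der_corput_constD[OF Cp])
      show "(D n has_real_derivative D (Suc n) \<xi>) (at \<xi> within {M / 2..e})"
        if "n < p" "\<xi> \<in> {M / 2..e}" for n \<xi>
        using dD[of n \<xi>] that \<open>e \<in> _\<close> by (auto elim!: DERIV_subset)
      show "continuous_on {M / 2..e} (D p)"
        using that by (intro continuous_on_subset[OF cDp]) auto
    qed (use that \<open>c > 0\<close> \<open>\<Lambda> > 0\<close> lowerD in auto)
    let ?\<psi> = "\<lambda>\<xi>. of_real (M powr s) * (P (\<xi> / M) * of_real ((\<xi> / M) powr s))"
    let ?\<psi>' = "\<lambda>\<xi>. of_real (M powr s) * (of_real (1 / M) * \<eta>' (\<xi> / M))"
    have "norm (osc_int g P \<delta> s t x k)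
        \<le> B * (norm (?\<psi> (2 * M)) + (M powr s * (1 / M * K)) * (2 * M - M / 2))"
      unfolding rep(2)
    proof (rule integral_amplitude_bound[where \<psi>' = ?\<psi>'])
      show "continuous_on {M / 2..2 * M} (\<lambda>\<xi>. cis (?\<phi> \<xi>))"
        by (intro continuous_intros rep(1))
      have "continuous_on {M / 2..2 * M} (\<lambda>\<xi>. \<eta>' (\<xi> / M))"
        by (rule continuous_on_compose2[OF K(2)]) (use scaled \<open>M > 0\<close> in \<open>auto intro!: continuous_intros\<close>)
      then show "continuous_on {M / 2..2 * M} ?\<psi>'"
        by (intro continuous_intros)
      show "(?\<psi> has_vector_derivative ?\<psi>' \<xi>) (at \<xi> within {M / 2..2 * M})"
        if "\<xi> \<in> {M / 2..2 * M}" for \<xi>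
      proof (rule has_vector_derivative_mult_right)
        have "((\<lambda>\<xi>. \<xi> / M) has_vector_derivative 1 / M) (at \<xi> within {M / 2..2 * M})"
          by (intro has_vector_derivative_divide has_vector_derivative_id)
        moreover have "((\<lambda>y. P y * of_real (y powr s)) has_vector_derivative \<eta>' (\<xi> / M))
            (at (\<xi> / M) within (\<lambda>\<xi>. \<xi> / M) ` {M / 2..2 * M})"
          by (rule has_vector_derivative_within_subset[OF bspec[OF K(3)]]) (use scaled that in auto)
        ultimately show "((\<lambda>\<xi>. P (\<xi> / M) * of_real ((\<xi> / M) powr s)) has_vector_derivative
            of_real (1 / M) * \<eta>' (\<xi> / M)) (at \<xi> within {M / 2..2 * M})"
          by (auto dest!: vector_diff_chain_within simp: o_def scaleR_conv_of_real)
      qed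
      show "norm (?\<psi>' \<xi>) \<le> M powr s * (1 / M * K)" if "\<xi> \<in> {M / 2..2 * M}" for \<xi>
        using bspec[OF K(5) scaled[OF that]] \<open>M > 0\<close>
        by (simp add: norm_mult norm_divide mult_left_mono divide_right_mono)
    qed (use B \<open>M > 0\<close> in auto)
    also have "\<dots> \<le> B * (M powr s * K + (M powr s * (1 / M * K)) * (2 * M - M / 2))"
      using K(4)[THEN bspec, OF scaled[of "2 * M"]] \<open>M > 0\<close> \<open>Cp > 0\<close>
      by (intro mult_left_mono add_right_mono) (simp_all add: norm_mult B_def)
    also have "\<dots> = B * (5 / 2 * K * M powr s)"
      using \<open>M > 0\<close> by (simp add: field_simps)
    also have "\<dots> = C * (M powr s * \<Lambda> powr (- 1 / real p))"
      using \<open>c > 0\<close> \<open>\<Lambda> > 0\<close> by (simp add: B_def C_def powr_mult)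
    finally show ?thesis
      by (simp add: M_def \<Lambda>_def N_def)
  qed
  moreover have "C > 0"
    using \<open>Cp > 0\<close> \<open>c > 0\<close> K(1) by (simp add: C_def)
  ultimately show thesis
    using that by blast
qed

section \<open>Conversion into powers of 2, \<delta> and |t|, and interpolation in l\<close>

theorem lemma2p5:
  fixes P :: "real \<Rightarrow> complex" and g :: "real \<Rightarrow> real" and J :: "real set"
    and lam \<alpha> s :: real and p :: nat
  assumes P_smooth: "\<And>n. Cn_on n P UNIV"
    and P_even: "\<And>y. P (- y) = P y"
    and P_supp: "closure {y. P y \<noteq> 0} \<subseteq> {y. 1/2 \<le> \<bar>y\<bar> \<and> \<bar>y\<bar> \<le> 2}"
    and J: "is_interval J" "J \<subseteq> {0..}"
    and lam: "lam > 0"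
    and p: "p \<ge> 2"
    and g_C2: "Cn_on 2 g {0<..}"
  shows "(Cn_on p g (J \<inter> {0<..}) \<and>
           (\<forall>y\<in>J \<inter> {0<..}. \<bar>nth_deriv (J \<inter> {0<..}) p g y\<bar> \<ge> lam * y powr \<alpha>) \<longrightarrow>
         (\<exists>C>0. \<forall>t \<delta>. \<forall>k\<in>dyadic_indices J. t \<noteq> 0 \<longrightarrow> \<delta> > 0 \<longrightarrow>
            (SUP x. ereal (norm (osc_int g P \<delta> s t x k)))
              \<le> ereal (C * (2 powr ((s - \<alpha> / real p) * of_int k)
                         * \<delta> powr ((1 - s * real p - real p) / real p)
                         / \<bar>t\<bar> powr (1 / real p)))))
       \<and> (\<forall>l::real. l \<ge> 2 \<longrightarrow>
           (\<forall>y\<in>J \<inter> {0<..}. \<bar>nth_deriv {0<..} 2 g y\<bar> \<ge> lam * y powr \<alpha>) \<longrightarrow>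
         (\<exists>C>0. \<forall>t \<delta>. \<forall>k\<in>dyadic_indices J. t \<noteq> 0 \<longrightarrow> \<delta> > 0 \<longrightarrow>
            (SUP x. ereal (norm (osc_int g P \<delta> s t x k)))
              \<le> ereal (C * (2 powr ((s + (l - 2 - \<alpha>) / l) * of_int k)
                         * \<delta> powr ((1 - s * l - l) / l)
                         / \<bar>t\<bar> powr (1 / l)))))"
proof -
  note P_supp' = order_trans[OF closure_subset P_supp]
  have two: "(2 :: real) powi k = 2 powr of_int k" for k
    by (simp add: powr_real_of_int')
  \<comment> \<open>\<open>J\<close> may contain 0, but the dyadic interval does not, so it lies
    where \<open>g\<close> is controlled.\<close>
  have J': "{2 powi k / 2..2 * 2 powi k} \<subseteq> J \<inter> {0<..}" if "k \<in> dyadic_indices J" for k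
  proof -
    have "y > 0" if "y \<in> {2 powi k / 2..2 * 2 powi k}" for y :: real
      using that less_le_trans[of 0 "2 powi k / 2" y] by simp
    then show ?thesis
      using that unfolding mem_dyadic_indices_iff by blast
  qed
  have "\<exists>C>0. \<forall>t \<delta>. \<forall>k\<in>dyadic_indices J. t \<noteq> 0 \<longrightarrow> \<delta> > 0 \<longrightarrow>
      (SUP x. ereal (norm (osc_int g P \<delta> s t x k)))
        \<le> ereal (C * (2 powr ((s - \<alpha> / real p) * of_int k)
                   * \<delta> powr ((1 - s * real p - real p) / real p) / \<bar>t\<bar> powr (1 / real p)))"
    if g: "Cn_on p g (J \<inter> {0<..})"
      and lower: "\<forall>y\<in>J \<inter> {0<..}. \<bar>nth_deriv (J \<inter> {0<..}) p g y\<bar> \<ge> lam * y powr \<alpha>"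
  proof -
    obtain C where "C > 0" and C: "\<And>g S \<delta> t x k. Cn_on p g S \<Longrightarrow> {2 powi k / 2..2 * 2 powi k} \<subseteq> S \<Longrightarrow>
      (\<And>y. y \<in> {2 powi k / 2..2 * 2 powi k} \<Longrightarrow> \<bar>nth_deriv S p g y\<bar> \<ge> lam * y powr \<alpha>) \<Longrightarrow>
      t \<noteq> 0 \<Longrightarrow> \<delta> > 0 \<Longrightarrow>
      norm (osc_int g P \<delta> s t x k)
        \<le> C * ((2 powi k / \<delta>) powr s * (\<bar>t\<bar> * \<delta> powr (real p - 1) * (2 powi k) powr \<alpha>) powr (- 1 / real p))"
      by (rule osc_int_van_der_corput_bound[OF P_smooth P_supp' p lam, where s = s and \<alpha> = \<alpha>], rule that, assumption) blast
    have "norm (osc_int g P \<delta> s t x k) \<le> C * (2 powr ((s - \<alpha> / real p) * of_int k)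
        * \<delta> powr ((1 - s * real p - real p) / real p) / \<bar>t\<bar> powr (1 / real p))"
      if "k \<in> dyadic_indices J" "t \<noteq> 0" "\<delta> > 0" for t \<delta> x k
    proof -
      \<comment> \<open>The exponent of \<open>\<delta>\<close> is
        \<open>- s - (p - 1) / p = (1 - s p - p) / p\<close>, and that of \<open>2 powi k\<close> is
        \<open>s - \<alpha> / p\<close>.\<close>
      have eq: "(2 powi k / \<delta>) powr s * (\<bar>t\<bar> * \<delta> powr (real p - 1) * (2 powi k) powr \<alpha>) powr (- 1 / real p)
          = 2 powr ((s - \<alpha> / real p) * of_int k) * \<delta> powr ((1 - s * real p - real p) / real p)
            / \<bar>t\<bar> powr (1 / real p)"
        using that p by (simp add: two powr_def ln_mult ln_div field_simps flip: exp_add exp_diff)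
      show ?thesis
        unfolding eq[symmetric]
        by (rule C[OF g J'[OF that(1)] _ that(2,3)]) (use lower J'[OF that(1)] in blast)
    qed
    with \<open>C > 0\<close> show ?thesis
      by (intro exI[of _ C]) (auto intro!: SUP_least)
  qed
  moreover have "\<exists>C>0. \<forall>t \<delta>. \<forall>k\<in>dyadic_indices J. t \<noteq> 0 \<longrightarrow> \<delta> > 0 \<longrightarrow>
      (SUP x. ereal (norm (osc_int g P \<delta> s t x k)))
        \<le> ereal (C * (2 powr ((s + (l - 2 - \<alpha>) / l) * of_int k)
                   * \<delta> powr ((1 - s * l - l) / l) / \<bar>t\<bar> powr (1 / l)))"
    if "l \<ge> 2" and lower: "\<forall>y\<in>J \<inter> {0<..}. \<bar>nth_deriv {0<..} 2 g y\<bar> \<ge> lam * y powr \<alpha>" for l :: real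
  proof -
    obtain C1 where "C1 > 0" and C1: "\<And>g S \<delta> t x k. Cn_on 2 g S \<Longrightarrow> {2 powi k / 2..2 * 2 powi k} \<subseteq> S \<Longrightarrow>
      (\<And>y. y \<in> {2 powi k / 2..2 * 2 powi k} \<Longrightarrow> \<bar>nth_deriv S 2 g y\<bar> \<ge> lam * y powr \<alpha>) \<Longrightarrow>
      t \<noteq> 0 \<Longrightarrow> \<delta> > 0 \<Longrightarrow>
      norm (osc_int g P \<delta> s t x k)
        \<le> C1 * ((2 powi k / \<delta>) powr s * (\<bar>t\<bar> * \<delta> powr (real 2 - 1) * (2 powi k) powr \<alpha>) powr (- 1 / real 2))"
      by (rule osc_int_van_der_corput_bound[OF P_smooth P_supp' order_refl lam, where s = s and \<alpha> = \<alpha>], rule that, assumption) blast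
    obtain C2 where "C2 > 0" and C2: "\<And>g \<delta> t x k. continuous_on {2 powi k / 2..2 * 2 powi k} g \<Longrightarrow>
      \<delta> > 0 \<Longrightarrow> norm (osc_int g P \<delta> s t x k) \<le> C2 * (2 powi k / \<delta>) powr (s + 1)"
      by (rule osc_int_trivial_bound[OF P_smooth P_supp', where s = s], rule that, assumption) blast
    \<comment> \<open>Which of the two bounds applies depends on \<open>t\<close>,
      \<open>\<delta>\<close> and \<open>k\<close>, so the constant has to cover both.\<close>
    define C where "C = max C1 C2"
    have "C > 0" using \<open>C1 > 0\<close> by (simp add: C_def)
    have "norm (osc_int g P \<delta> s t x k) \<le> C * (2 powr ((s + (l - 2 - \<alpha>) / l) * of_int k)
        * \<delta> powr ((1 - s * l - l) / l) / \<bar>t\<bar> powr (1 / l))"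
      if k: "k \<in> dyadic_indices J" and "t \<noteq> 0" "\<delta> > 0" for t \<delta> x k
    proof -
      define M where "M = 2 powi k / \<delta>"
      \<comment> \<open>This is \<open>\<Lambda> M\<^sup>2\<close> with \<open>\<Lambda> =
        \<bar>t\<bar> * \<delta> * (2 powi k) powr \<alpha>\<close>. It measures the oscillation
        after rescaling to unit length and decides between the two bounds.\<close>
      define A where "A = \<bar>t\<bar> / \<delta> * (2 powi k) powr (\<alpha> + 2)"
      have "M > 0" "A > 0" using that by (simp_all add: M_def A_def)
      have first: "norm (osc_int g P \<delta> s t x k) \<le> C1 * (M powr (s + 1) * A powr (- 1 / 2))"
      proof -
        have eq: "M powr s * (\<bar>t\<bar> * \<delta> powr (real 2 - 1) * (2 powi k) powr \<alpha>) powr (- 1 / real 2)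
            = M powr (s + 1) * A powr (- 1 / 2)"
          unfolding M_def A_def using that
          by (simp add: two powr_def ln_mult ln_div field_simps flip: exp_add exp_diff)
        show ?thesis
          unfolding eq[symmetric] unfolding M_def
          by (rule C1[OF g_C2 _ _ \<open>t \<noteq> 0\<close> \<open>\<delta> > 0\<close>]) (use lower J'[OF k] in blast)+
      qed
      have trivial: "norm (osc_int g P \<delta> s t x k) \<le> C2 * M powr (s + 1)"
      proof -
        have "continuous_on {0<..} g"
          using Cn_on_imp_has_vector_derivative[OF g_C2, of 0]
          by (intro continuous_on_vector_derivative[of _ _ "nth_deriv {0<..} 1 g"]) auto
        then show ?thesis
          unfolding M_def using J'[OF k] \<open>\<delta> > 0\<close> by (intro C2) (auto elim: continuous_on_subset)
      qed
      \<comment> \<open>For \<open>A \<ge> 1\<close>, raising the exponent from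
        \<open>- 1 / 2\<close> to \<open>- 1 / l\<close> only weakens the van der Corput bound. For
        \<open>A < 1\<close>, the factor \<open>A powr (- 1 / l)\<close> is at least 1, so the
        trivial bound suffices.\<close>
      have "norm (osc_int g P \<delta> s t x k) \<le> C * (M powr (s + 1) * A powr (- 1 / l))"
      proof (cases "A \<ge> 1")
        case True
        have "A powr (- 1 / 2) \<le> A powr (- 1 / l)"
          using True \<open>l \<ge> 2\<close> by (intro powr_mono) (auto simp: field_simps)
        then have "C1 * (M powr (s + 1) * A powr (- 1 / 2)) \<le> C * (M powr (s + 1) * A powr (- 1 / l))"
          using \<open>C1 > 0\<close> by (intro mult_mono) (auto simp: C_def)
        with first show ?thesis by simp
      next
        case False
        have "1 \<le> A powr (- 1 / l)"
          using powr_mono2'[of "- 1 / l" A 1] False \<open>A > 0\<close> \<open>l \<ge> 2\<close> by simp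
        then have "C2 * (M powr (s + 1) * 1) \<le> C * (M powr (s + 1) * A powr (- 1 / l))"
          using \<open>C2 > 0\<close> by (intro mult_mono) (auto simp: C_def)
        with trivial show ?thesis by simp
      qed
      \<comment> \<open>Here \<open>2 powi k\<close> has exponent
        \<open>s + 1 - (\<alpha> + 2) / l\<close>, and \<open>\<delta>\<close> has exponent
        \<open>- (s + 1) + 1 / l\<close>.\<close>
      also have "M powr (s + 1) * A powr (- 1 / l) = 2 powr ((s + (l - 2 - \<alpha>) / l) * of_int k)
          * \<delta> powr ((1 - s * l - l) / l) / \<bar>t\<bar> powr (1 / l)"
        unfolding M_def A_def using that \<open>l \<ge> 2\<close>
        by (simp add: two powr_def ln_mult ln_div field_simps flip: exp_add exp_diff)
      finally show ?thesis .
    qed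
    with \<open>C > 0\<close> show ?thesis
      by (intro exI[of _ C]) (auto intro!: SUP_least)
  qed
  ultimately show ?thesis
    by blast
qed

end
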